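(* Let $\bm{x}\in\mathbb{C}^{NT}$ represent a time-vertex signal, and let $\mathbf{D}_J$ and $\mathbf{B}_J^{\alpha,\beta}$ be the joint support projection operator and the joint frequency projection operator (defined in the context) associated with $\mathcal{S}_G\subset\mathcal{V}$, $\mathcal{S}_T\subset\mathcal{T}$, $\mathcal{F}_G\subset\{1,\dots,N\}$, $\mathcal{F}_T\subset\{1,\dots,T\}$ and orders $\alpha,\beta\in\mathbb{R}$. Then $\bm{x}$ is perfectly localized over $\mathcal{S}_G\times\mathcal{S}_T$ and $\mathcal{F}_G\times\mathcal{F}_T$ (that is, $\mathbf{D}_J\bm{x}=\bm{x}$ and $\mathbf{B}_J^{\alpha,\beta}\bm{x}=\bm{x}$) if and only if $$\lambda_{\max}\left(\mathbf{B}_J^{\alpha,\beta}\,\mathbf{D}_J\,\mathbf{B}_J^{\alpha,\beta}\right)=1,$$ where $\lambda_{\max}$ denotes the largest eigenvalue. In this case, $\bm{x}$ is an eigenvector of $\mathbf{B}_J^{\alpha,\beta}\mathbf{D}_J\mathbf{B}_J^{\alpha,\beta}$ associated with the unit eigenvalue. Equivalently, this condition is characterized by $$\left\|\mathbf{B}_J^{\alpha,\beta}\mathbf{D}_J\right\|_2=\left\|\mathbf{D}_J\mathbf{B}_J^{\alpha,\beta}\right\|_2=1,$$ where $\|\cdot\|_2$ is the spectral norm.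
   Context: Time-vertex signals: a signal on a graph with vertex set $\mathcal{V}$ of $N$ vertices over a set $\mathcal{T}$ of $T$ time instants is a matrix $\mathbf{X}\in\mathbb{C}^{N\times T}$, identified with $\bm{x}=\mathrm{vec}(\mathbf{X})\in\mathbb{C}^{NT}$ (column stacking). Discrete fractional Fourier transform of order $\alpha$: the $T\times T$ matrix $\mathbf{F}^{\alpha}$ with entries $\mathbf{F}^{\alpha}[m,n]=\sum_{k=0}^{T-1}\bm{u}_k[m]\,e^{j\frac{\pi}{2}k\alpha}\,\bm{u}_k[n]$, where $j=\sqrt{-1}$ and $\bm{u}_k$ is the $k$-th discrete Hermite-Gaussian sequence (eigenvector of the DFT matrix); its inverse is $\mathbf{F}^{-\alpha}$. Graph fractional Fourier transform of order $\beta$: let $\mathbf{S}=\mathbf{U}\mathbf{\Delta}\mathbf{U}^{-1}$ be the eigendecomposition of a graph shift operator (e.g. adjacency matrix or Laplacian) and let $\mathbf{U}^{-1}=\mathbf{Q}\mathbf{\Lambda}\mathbf{Q}^{-1}$ with $\mathbf{\Lambda}$ diagonal. The $N\times N$ matrix of the transform is $\mathbf{F}^{\beta}=\mathbf{Q}\mathbf{\Lambda}^{\beta}\mathbf{Q}^{-1}$ (each diagonal entry of $\mathbf{\Lambda}$ raised to the power $\beta$), with inverse $\mathbf{F}^{-\beta}=\mathbf{Q}\mathbf{\Lambda}^{-\beta}\mathbf{Q}^{-1}$. The symbols $\mathbf{F}^\alpha$ ($T\times T$) and $\mathbf{F}^\beta$ ($N\times N$) denote different families of matrices, distinguished by the letter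 of the order. For an index set $\mathcal{A}$, $\mathbf{1}_{\mathcal{A}}$ is its $0/1$ indicator vector. Define $\mathbf{D}_G=\mathrm{diag}(\mathbf{1}_{\mathcal{S}_G})$, $\mathbf{D}_T=\mathrm{diag}(\mathbf{1}_{\mathcal{S}_T})$, $\mathbf{B}_G^{\beta}=\mathbf{F}^{-\beta}\,\mathrm{diag}(\mathbf{1}_{\mathcal{F}_G})\,\mathbf{F}^{\beta}$, $\mathbf{B}_T^{\alpha}=\mathbf{F}^{-\alpha}\,\mathrm{diag}(\mathbf{1}_{\mathcal{F}_T})\,\mathbf{F}^{\alpha}$, and the joint operators $\mathbf{D}_J=\mathbf{D}_T\otimes\mathbf{D}_G$, $\mathbf{B}_J^{\alpha,\beta}=\mathbf{B}_T^{\alpha}\otimes\mathbf{B}_G^{\beta}$ (Kronecker products). Standing assumption: these support-limiting and band-limiting operators are Hermitian and idempotent, i.e. orthogonal projectors.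
   Formalization: For a fixed x the equivalence fails (x = 0, or x outside the unit eigenspace); proved instead: some nonzero x is perfectly localized iff λ_max = 1, and a nonzero x is perfectly localized iff λ_max = 1 and x is an eigenvector for eigenvalue 1. *)

theory Defs
  imports
    "HOL-Analysis.Complex_Transcendental"
    "HOL-Analysis.L2_Norm"
    "Jordan_Normal_Form.Schur_Decomposition"
begin

(* Vertices, time instants and frequency indices are all counted from 0. *)

definition kron :: "complex mat \<Rightarrow> complex mat \<Rightarrow> complex mat" where
  "kron A B = Matrix.mat (dim_row A * dim_row B) (dim_col A * dim_col B)
     (\<lambda>(i, j). A $$ (i div dim_row B, j div dim_col B) * B $$ (i mod dim_row B, j mod dim_col B))"
(* A signal X (N x T) is its column stacking x with x $ (t * N + n) = X $$ (n, t), so that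
   kron A B * x stacks B * X * transpose A for A of size T x T and B of size N x N. *)

definition indicator_diag :: "nat \<Rightarrow> nat set \<Rightarrow> complex mat" where
  "indicator_diag n A = mat_diag n (\<lambda>i. if i \<in> A then 1 else 0)"

definition orthogonal_projector :: "complex mat \<Rightarrow> bool" where
  "orthogonal_projector P \<longleftrightarrow> square_mat P \<and> mat_adjoint P = P \<and> P * P = P"

definition dft_mat :: "nat \<Rightarrow> complex mat" where
  "dft_mat T = Matrix.mat T T
     (\<lambda>(m, n). cis (- 2 * pi * real m * real n / real T) / complex_of_real (sqrt (real T)))"

(* The discrete counterpart of the Hermite differential operator: periodic second difference
   plus the potential 2 cos(2 pi n / T) - 2. It commutes with the DFT and with index reversal.
   The three summands are added so that the cyclic neighbours are also right for T = 1, 2. *)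
definition discrete_hermite_mat :: "nat \<Rightarrow> real mat" where
  "discrete_hermite_mat T = Matrix.mat T T (\<lambda>(m, n).
     (if m = n then 2 * cos (2 * pi * real m / real T) - 4 else 0)
     + (if n = (m + 1) mod T then 1 else 0)
     + (if m = (n + 1) mod T then 1 else 0))"

(* u 0, ..., u (T - 1) are the discrete Hermite-Gaussian sequences of Candan, Kutay and Ozaktas
   ("The discrete fractional Fourier transform", IEEE Trans. Signal Process. 48, 2000):
   the real orthonormal common eigenvectors of the DFT and of discrete_hermite_mat, those of
   each parity being ordered by decreasing eigenvalue of the latter (that is, by increasing
   number of zero crossings). Restricted to sequences of one parity discrete_hermite_mat has
   simple spectrum, so each u k is unique up to its sign.
   The parity of u k is that of k, except that for even T the last sequence is even as well:
   there are T div 2 + 1 independent even sequences. *)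
definition discrete_hermite_gaussian :: "nat \<Rightarrow> (nat \<Rightarrow> real Matrix.vec) \<Rightarrow> bool" where
  "discrete_hermite_gaussian T u \<longleftrightarrow>
     (let even_index = (\<lambda>k. even k \<or> k = T - 1) in
      (\<forall>k<T. u k \<in> carrier_vec T) \<and>
      (\<forall>j<T. \<forall>k<T. scalar_prod (u j) (u k) = (if j = k then 1 else 0)) \<and>
      (\<forall>k<T. \<exists>c. eigenvector (dft_mat T) (map_vec complex_of_real (u k)) c) \<and>
      (\<forall>k<T. \<forall>n<T. Matrix.vec_index (u k) ((T - n) mod T)
                    = (if even_index k then 1 else - 1) * Matrix.vec_index (u k) n) \<and>
      (\<exists>\<mu>. (\<forall>k<T. eigenvector (discrete_hermite_mat T) (u k) (\<mu> k)) \<and>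
            (\<forall>j k. j < k \<longrightarrow> k < T \<longrightarrow> even_index j = even_index k \<longrightarrow> \<mu> k < \<mu> j)))"

definition dfrft_mat :: "nat \<Rightarrow> (nat \<Rightarrow> real Matrix.vec) \<Rightarrow> real \<Rightarrow> complex mat" where
  "dfrft_mat T u \<alpha> = Matrix.mat T T (\<lambda>(m, n).
     \<Sum>k<T. complex_of_real (Matrix.vec_index (u k) m) * exp (\<i> * (pi / 2) * real k * \<alpha>)
            * complex_of_real (Matrix.vec_index (u k) n))"

definition graph_shift_operator :: "nat \<Rightarrow> (nat \<times> nat) set \<Rightarrow> complex mat \<Rightarrow> bool" where
  "graph_shift_operator N E S \<longleftrightarrow> S \<in> carrier_mat N N \<and>
     (\<forall>i<N. \<forall>j<N. i \<noteq> j \<longrightarrow> (i, j) \<notin> E \<longrightarrow> S $$ (i, j) = 0)"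

(* S = U \<Delta> U^-1 is an eigendecomposition and U^-1 = Q \<Lambda> Q^-1 diagonalises the transform;
   Ui and Qi are the inverses of U and Q. *)
definition gft_decomposition ::
  "complex mat \<Rightarrow> complex mat \<Rightarrow> complex mat \<Rightarrow> complex mat \<Rightarrow> complex mat \<Rightarrow> complex mat \<Rightarrow> complex mat \<Rightarrow> bool"
  where
  "gft_decomposition S \<Delta> U Ui \<Lambda> Q Qi \<longleftrightarrow>
     similar_mat_wit S \<Delta> U Ui \<and> diagonal_mat \<Delta> \<and>
     similar_mat_wit Ui \<Lambda> Q Qi \<and> diagonal_mat \<Lambda>"

(* Powers of the (nonzero, complex) diagonal entries are principal powers. *)
definition gfrft_mat :: "complex mat \<Rightarrow> complex mat \<Rightarrow> complex mat \<Rightarrow> real \<Rightarrow> complex mat" where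
  "gfrft_mat \<Lambda> Q Qi \<beta> =
     Q * mat_diag (dim_row \<Lambda>) (\<lambda>i. (\<Lambda> $$ (i, i)) powr complex_of_real \<beta>) * Qi"

definition time_band_op :: "nat \<Rightarrow> (nat \<Rightarrow> real Matrix.vec) \<Rightarrow> real \<Rightarrow> nat set \<Rightarrow> complex mat" where
  "time_band_op T u \<alpha> F = dfrft_mat T u (- \<alpha>) * indicator_diag T F * dfrft_mat T u \<alpha>"

definition graph_band_op ::
  "nat \<Rightarrow> complex mat \<Rightarrow> complex mat \<Rightarrow> complex mat \<Rightarrow> real \<Rightarrow> nat set \<Rightarrow> complex mat" where
  "graph_band_op N \<Lambda> Q Qi \<beta> F = gfrft_mat \<Lambda> Q Qi (- \<beta>) * indicator_diag N F * gfrft_mat \<Lambda> Q Qi \<beta>"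

definition perfectly_localized :: "complex mat \<Rightarrow> complex mat \<Rightarrow> complex Matrix.vec \<Rightarrow> bool" where
  "perfectly_localized D B x \<longleftrightarrow> D *\<^sub>v x = x \<and> B *\<^sub>v x = x"

(* Meant for Hermitian matrices, all of whose eigenvalues are real. *)
definition lambda_max :: "complex mat \<Rightarrow> real" where
  "lambda_max A = Max {r. eigenvalue A (complex_of_real r)}"

definition l2_norm :: "complex Matrix.vec \<Rightarrow> real" where
  "l2_norm v = L2_set (\<lambda>i. cmod (Matrix.vec_index v i)) {..<dim_vec v}"

definition spectral_norm :: "complex mat \<Rightarrow> real" where
  "spectral_norm A = (SUP v \<in> {v \<in> carrier_vec (dim_col A). l2_norm v = 1}. l2_norm (A *\<^sub>v v))"

end

theory Submission
  imports Defs "Jordan_Normal_Form.Spectral_Radius"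
begin

(* Kronecker products of orthogonal projectors are orthogonal projectors, so the theorem is about
   two projectors D and B on C^n. A projector is a contraction that preserves the norm of exactly
   the vectors it fixes; hence B D B x = x forces B x = x and D x = x. All eigenvalues of B D B are
   real and at most 1, so its largest one is 1 iff 1 is an eigenvalue. If 1 is not an eigenvalue,
   then 1 - B D B is invertible, and |(1 - B D B) v|^2 <= 1 - |D B v|^2 for unit vectors v keeps
   |D B v| away from 1. *)

subsection \<open>Euclidean norm\<close>

lemma l2_norm_nonneg: "0 \<le> l2_norm v"
  by (simp add: l2_norm_def L2_set_nonneg)

text \<open>Stated over the complex numbers because the inner product lives there. Norm computations
  below expand inner products in this form and return to the reals by injectivity of
  \<open>complex_of_real\<close>.\<close>

lemma l2_norm_square:
  "complex_of_real ((l2_norm v)\<^sup>2) = scalar_prod v (conjugate v)"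
  by (simp add: l2_norm_def L2_set_def scalar_prod_def sum_nonneg complex_norm_square
      atLeast0LessThan del: of_real_power)

lemma l2_norm_eq_0_iff:
  assumes "v \<in> carrier_vec n"
  shows "l2_norm v = 0 \<longleftrightarrow> v = 0\<^sub>v n"
proof -
  have "l2_norm v = 0 \<longleftrightarrow> complex_of_real ((l2_norm v)\<^sup>2) = 0"
    by simp
  then show ?thesis
    unfolding l2_norm_square using conjugate_square_eq_0_vec[OF assms] by simp
qed

lemma l2_norm_smult: "l2_norm (c \<cdot>\<^sub>v v) = cmod c * l2_norm v"
proof -
  have "l2_norm (c \<cdot>\<^sub>v v) = L2_set (\<lambda>i. cmod c * cmod (vec_index v i)) {..<dim_vec v}"
    unfolding l2_norm_def by (intro L2_set_cong) (auto simp: norm_mult)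
  then show ?thesis by (simp add: l2_norm_def L2_set_right_distrib)
qed

text \<open>Each entry of \<open>v\<close> is at most \<open>l2_norm v\<close> in modulus, and the
  Euclidean norm is at most the sum of the moduli. So the sum of the moduli of all entries of
  \<open>M\<close> serves as \<open>K\<close>; any finite constant is good enough.\<close>

lemma l2_norm_mult_mat_vec_bound:
  fixes M :: "complex mat"
  shows
  "\<exists>K. \<forall>v \<in> carrier_vec (dim_col M). l2_norm (M *\<^sub>v v) \<le> K * l2_norm v"
proof (intro exI ballI)
  fix v :: "complex Matrix.vec" assume v: "v \<in> carrier_vec (dim_col M)"
  have entry: "cmod (vec_index v j) \<le> l2_norm v" if "j < dim_col M" for j
    unfolding l2_norm_def using that v by (intro member_le_L2_set) auto
  have row: "cmod (vec_index (M *\<^sub>v v) i) \<le> (\<Sum>j<dim_col M. cmod (M $$ (i, j))) * l2_norm v"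
    if "i < dim_row M" for i
  proof -
    have "cmod (vec_index (M *\<^sub>v v) i) \<le> (\<Sum>j<dim_col M. cmod (M $$ (i, j) * vec_index v j))"
      using that v by (auto simp: scalar_prod_def atLeast0LessThan intro: norm_sum)
    also have "\<dots> \<le> (\<Sum>j<dim_col M. cmod (M $$ (i, j)) * l2_norm v)"
      by (intro sum_mono) (auto simp: norm_mult intro!: mult_left_mono entry)
    finally show ?thesis by (simp add: sum_distrib_right)
  qed
  have "l2_norm (M *\<^sub>v v) \<le> (\<Sum>i<dim_row M. cmod (vec_index (M *\<^sub>v v) i))"
    unfolding l2_norm_def dim_mult_mat_vec by (rule L2_set_le_sum) simp
  also have "\<dots> \<le> (\<Sum>i<dim_row M. (\<Sum>j<dim_col M. cmod (M $$ (i, j))) * l2_norm v)"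
    by (intro sum_mono row) simp
  finally show "l2_norm (M *\<^sub>v v)
      \<le> (\<Sum>i<dim_row M. \<Sum>j<dim_col M. cmod (M $$ (i, j))) * l2_norm v"
    by (simp add: sum_distrib_right)
qed

text \<open>Without the eigenvalue 1 the matrix \<open>1 - A\<close> has an inverse
  \<open>M\<close>, and \<open>v = M (v - A v)\<close>; a bound for \<open>M\<close> is the required
  \<open>K\<close>. This supplies the uniform gap that a compactness argument on the unit sphere
  would otherwise give.\<close>

lemma l2_norm_le_diff_of_not_eigenvalue:
  fixes A :: "complex mat"
  assumes A: "A \<in> carrier_mat n n" and "\<not> eigenvalue A 1"
  obtains K where "\<And>v. v \<in> carrier_vec n \<Longrightarrow> l2_norm v \<le> K * l2_norm (v - A *\<^sub>v v)"
proof -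
  define C where "C = 1\<^sub>m n - A"
  have C: "C \<in> carrier_mat n n" using A by (auto simp: C_def)
  have Cv: "C *\<^sub>v v = v - A *\<^sub>v v" if "v \<in> carrier_vec n" for v
    using A that minus_mult_distrib_mat_vec[of "1\<^sub>m n" n n A v] by (simp add: C_def)
  have "det C \<noteq> 0"
  proof
    assume "det C = 0"
    then obtain v where v: "v \<in> carrier_vec n" "v \<noteq> 0\<^sub>v n" "C *\<^sub>v v = 0\<^sub>v n"
      using det_0_iff_vec_prod_zero[OF C] by auto
    have "A *\<^sub>v v = v"
    proof (rule eq_vecI)
      fix i assume "i < dim_vec v"
      then show "vec_index (A *\<^sub>v v) i = vec_index v i"
        using arg_cong[OF v(3), of "\<lambda>w. vec_index w i"] v(1) A by (simp add: Cv)
    qed (use A v in auto)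
    then have "eigenvector A v 1"
      using A v by (auto simp: eigenvector_def)
    then show False using assms(2) by (auto simp: eigenvalue_def)
  qed
  \<comment> \<open>The nonzero determinant makes \<open>C\<close> a unit of the ring of square
    matrices; \<open>()\<close> only fills the extension slot of the ring record.\<close>
  then obtain M where M: "M \<in> carrier_mat n n" and MC: "M * C = 1\<^sub>m n"
    using det_non_zero_imp_unit[OF C, of "()"] unfolding Units_def ring_mat_def by auto
  obtain K where K: "\<And>w. w \<in> carrier_vec n \<Longrightarrow> l2_norm (M *\<^sub>v w) \<le> K * l2_norm w"
    using l2_norm_mult_mat_vec_bound[of M] M by auto
  show thesis
  proof
    fix v :: "complex Matrix.vec" assume v: "v \<in> carrier_vec n"
    have "M *\<^sub>v (C *\<^sub>v v) = v"
      using assoc_mult_mat_vec[OF M C v] MC v by simp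
    then show "l2_norm v \<le> K * l2_norm (v - A *\<^sub>v v)"
      using K[OF mult_mat_vec_carrier[OF C v]] v by (simp add: Cv)
  qed
qed

subsection \<open>Orthogonal projectors\<close>

lemma mat_adjoint_dim [simp]:
  "dim_row (mat_adjoint A) = dim_col A" "dim_col (mat_adjoint A) = dim_row A"
  by (simp_all add: mat_adjoint_def)

lemma mat_adjoint_index [simp]:
  assumes "i < dim_col A" "j < dim_row A"
  shows "mat_adjoint A $$ (i, j) = conjugate (A $$ (j, i))"
  using assms by (simp add: mat_adjoint_def mat_of_rows_index)

text \<open>Both sides are the same double sum, with the order of summation exchanged. The inner
  product is conjugate-linear in its second argument.\<close>

lemma scalar_prod_mat_adjoint:
  fixes A :: "complex mat"
  assumes A: "A \<in> carrier_mat m n" and v: "v \<in> carrier_vec n" and w: "w \<in> carrier_vec m"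
  shows "scalar_prod (A *\<^sub>v v) (conjugate w) = scalar_prod v (conjugate (mat_adjoint A *\<^sub>v w))"
proof -
  have "scalar_prod (A *\<^sub>v v) (conjugate w)
      = (\<Sum>i<m. \<Sum>j<n. A $$ (i, j) * vec_index v j * cnj (vec_index w i))"
    using A v w by (simp add: scalar_prod_def atLeast0LessThan sum_distrib_right)
  also have "\<dots> = (\<Sum>j<n. \<Sum>i<m. A $$ (i, j) * vec_index v j * cnj (vec_index w i))"
    by (rule sum.swap)
  also have "\<dots> = scalar_prod v (conjugate (mat_adjoint A *\<^sub>v w))"
    using A v w by (simp add: scalar_prod_def atLeast0LessThan sum_distrib_left mult_ac)
  finally show ?thesis .
qed

context
  fixes P :: "complex mat" and n :: nat
  assumes proj: "orthogonal_projector P" and P: "P \<in> carrier_mat n n"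
begin

lemma orthogonal_projector_self_adjoint:
  assumes "v \<in> carrier_vec n" "w \<in> carrier_vec n"
  shows "scalar_prod (P *\<^sub>v v) (conjugate w) = scalar_prod v (conjugate (P *\<^sub>v w))"
  using scalar_prod_mat_adjoint[OF P assms] proj by (simp add: orthogonal_projector_def)

lemma orthogonal_projector_idem:
  assumes "v \<in> carrier_vec n"
  shows "P *\<^sub>v (P *\<^sub>v v) = P *\<^sub>v v"
  using assoc_mult_mat_vec[OF P P assms] proj by (simp add: orthogonal_projector_def)

text \<open>In the inner product of \<open>P v\<close> with itself, self-adjointness moves the
  second \<open>P\<close> to the left, where idempotency absorbs it.\<close>

lemma orthogonal_projector_l2_norm_square:
  assumes v: "v \<in> carrier_vec n"
  shows "complex_of_real ((l2_norm (P *\<^sub>v v))\<^sup>2) = scalar_prod (P *\<^sub>v v) (conjugate v)"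
proof -
  have Pv: "P *\<^sub>v v \<in> carrier_vec n" using P v by simp
  show ?thesis
    unfolding l2_norm_square
    using orthogonal_projector_self_adjoint[OF Pv v] orthogonal_projector_idem[OF v] by simp
qed

text \<open>Expanding the squared norm of \<open>v - P v\<close>, both cross terms equal the squared
  norm of \<open>P v\<close>, so one copy of it remains with a minus sign.\<close>

lemma orthogonal_projector_pythagoras:
  assumes v: "v \<in> carrier_vec n"
  shows "(l2_norm v)\<^sup>2 = (l2_norm (P *\<^sub>v v))\<^sup>2 + (l2_norm (v - P *\<^sub>v v))\<^sup>2"
proof -
  have Pv: "P *\<^sub>v v \<in> carrier_vec n" using P v by simp
  have conj_diff: "conjugate (v - P *\<^sub>v v) = conjugate v - conjugate (P *\<^sub>v v)"
    using v Pv P by (intro eq_vecI) auto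
  have "complex_of_real ((l2_norm (v - P *\<^sub>v v))\<^sup>2)
      = complex_of_real ((l2_norm v)\<^sup>2) - complex_of_real ((l2_norm (P *\<^sub>v v))\<^sup>2)"
    using v Pv orthogonal_projector_self_adjoint[OF v v]
      orthogonal_projector_l2_norm_square[OF v]
    by (simp add: l2_norm_square conj_diff minus_scalar_prod_distrib scalar_prod_minus_distrib
        carrier_vec_conjugate del: of_real_power)
  then show ?thesis
    by (simp flip: of_real_diff del: of_real_power)
qed

lemma orthogonal_projector_contraction:
  assumes v: "v \<in> carrier_vec n"
  shows "l2_norm (P *\<^sub>v v) \<le> l2_norm v"
  using orthogonal_projector_pythagoras[OF v] l2_norm_nonneg
  by (metis le_add_same_cancel1 power2_le_imp_le zero_le_power2)

text \<open>If the projection loses no length, Pythagoras leaves nothing for the residual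
  \<open>v - P v\<close>.\<close>

lemma orthogonal_projector_fixed:
  assumes v: "v \<in> carrier_vec n" and "l2_norm v \<le> l2_norm (P *\<^sub>v v)"
  shows "P *\<^sub>v v = v"
proof -
  have Pv: "P *\<^sub>v v \<in> carrier_vec n" using P v by simp
  have "l2_norm v = l2_norm (P *\<^sub>v v)"
    using assms orthogonal_projector_contraction[OF v] by simp
  then have "l2_norm (v - P *\<^sub>v v) = 0"
    using orthogonal_projector_pythagoras[OF v] by simp
  moreover have "v - P *\<^sub>v v \<in> carrier_vec n" using v Pv by simp
  ultimately have diff: "v - P *\<^sub>v v = 0\<^sub>v n" using l2_norm_eq_0_iff by blast
  show ?thesis
  proof (rule eq_vecI)
    fix i assume "i < dim_vec v"
    then show "vec_index (P *\<^sub>v v) i = vec_index v i"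
      using arg_cong[OF diff, of "\<lambda>w. vec_index w i"] v P by simp
  qed (use P v in auto)
qed

end

subsection \<open>Two orthogonal projectors\<close>

context
  fixes D B :: "complex mat" and n :: nat
  assumes projD: "orthogonal_projector D" and D: "D \<in> carrier_mat n n"
    and projB: "orthogonal_projector B" and B: "B \<in> carrier_mat n n"
begin

section \<open>Fixed vectors of \<open>B * D * B\<close>\<close>

lemma mult_three_mat_vec:
  assumes "v \<in> carrier_vec n"
  shows "(B * D * B) *\<^sub>v v = B *\<^sub>v (D *\<^sub>v (B *\<^sub>v v))"
  using assms B D assoc_mult_mat_vec[of "B * D" n n B n v] assoc_mult_mat_vec[of B n n D n "B *\<^sub>v v"]
  by simp

lemma perfectly_localized_iff_fixed:
  assumes x: "x \<in> carrier_vec n"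
  shows "perfectly_localized D B x \<longleftrightarrow> (B * D * B) *\<^sub>v x = x"
proof
  assume "perfectly_localized D B x"
  then show "(B * D * B) *\<^sub>v x = x"
    using mult_three_mat_vec[OF x] by (simp add: perfectly_localized_def)
next
  assume "(B * D * B) *\<^sub>v x = x"
  then have fixed: "B *\<^sub>v (D *\<^sub>v (B *\<^sub>v x)) = x" using mult_three_mat_vec[OF x] by simp
  have "D *\<^sub>v (B *\<^sub>v x) \<in> carrier_vec n" using B D x by simp
  \<comment> \<open>The fixed-point equation exhibits \<open>x\<close> as a value of
    \<open>B\<close>, and \<open>B\<close> fixes its range.\<close>
  then have Bx: "B *\<^sub>v x = x" using orthogonal_projector_idem[OF projB B] fixed by metis
  \<comment> \<open>Now \<open>x = B (D x)\<close>, so contractivity of \<open>B\<close> shows that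
    \<open>D\<close> cannot shorten \<open>x\<close>.\<close>
  then have "l2_norm x \<le> l2_norm (D *\<^sub>v x)"
    using orthogonal_projector_contraction[OF projB B, of "D *\<^sub>v x"] fixed D x by simp
  then show "perfectly_localized D B x"
    using orthogonal_projector_fixed[OF projD D x] Bx by (simp add: perfectly_localized_def)
qed

lemma perfectly_localized_iff_eigenvector:
  assumes x: "x \<in> carrier_vec n" and "x \<noteq> 0\<^sub>v n"
  shows "perfectly_localized D B x \<longleftrightarrow> eigenvector (B * D * B) x 1"
  using assms perfectly_localized_iff_fixed[OF x] B by (auto simp: eigenvector_def)

lemma ex_perfectly_localized_iff_eigenvalue:
  "(\<exists>x \<in> carrier_vec n. x \<noteq> 0\<^sub>v n \<and> perfectly_localized D B x) \<longleftrightarrow> eigenvalue (B * D * B) 1"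
proof -
  have "x \<in> carrier_vec n \<and> x \<noteq> 0\<^sub>v n" if "eigenvector (B * D * B) x 1" for x
    using that B by (auto simp: eigenvector_def)
  then show ?thesis
    using perfectly_localized_iff_eigenvector unfolding eigenvalue_def by blast
qed

section \<open>Quadratic form, largest eigenvalue and spectral norm\<close>

lemma scalar_prod_three_mat:
  assumes x: "x \<in> carrier_vec n"
  shows "scalar_prod ((B * D * B) *\<^sub>v x) (conjugate x)
    = complex_of_real ((l2_norm (D *\<^sub>v (B *\<^sub>v x)))\<^sup>2)"
  unfolding mult_three_mat_vec[OF x]
  using orthogonal_projector_self_adjoint[OF projB B _ x, of "D *\<^sub>v (B *\<^sub>v x)"]
    orthogonal_projector_l2_norm_square[OF projD D, of "B *\<^sub>v x"] B D x
  by (simp del: of_real_power)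

lemma l2_norm_mult_projectors_le:
  assumes "x \<in> carrier_vec n"
  shows "l2_norm (D *\<^sub>v (B *\<^sub>v x)) \<le> l2_norm x"
  using orthogonal_projector_contraction[OF projD D, of "B *\<^sub>v x"]
    orthogonal_projector_contraction[OF projB B assms] B assms by simp

text \<open>An eigenvalue is the Rayleigh quotient of its eigenvector: here the squared norm of
  \<open>D (B x)\<close> over that of \<open>x\<close>, which is real and at most 1 since both
  projectors are contractions.\<close>

lemma eigenvalue_three_mat:
  assumes "eigenvalue (B * D * B) c"
  obtains r where "c = complex_of_real r" "r \<le> 1"
proof -
  obtain x where x: "x \<in> carrier_vec n" "x \<noteq> 0\<^sub>v n" and eig: "(B * D * B) *\<^sub>v x = c \<cdot>\<^sub>v x"
    using assms B by (auto simp: eigenvalue_def eigenvector_def)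
  define s where "s = (l2_norm x)\<^sup>2"
  define t where "t = (l2_norm (D *\<^sub>v (B *\<^sub>v x)))\<^sup>2"
  have "c * complex_of_real s = complex_of_real t"
    using scalar_prod_three_mat[OF x(1)] x(1)
    by (simp add: eig s_def t_def l2_norm_square del: of_real_power)
  moreover have "s > 0"
    using x l2_norm_eq_0_iff[OF x(1)] by (simp add: s_def)
  ultimately have "c = complex_of_real (t / s)" by (simp add: field_simps)
  moreover have "t \<le> s"
    unfolding s_def t_def by (intro power_mono l2_norm_mult_projectors_le x l2_norm_nonneg)
  ultimately show thesis using that[of "t / s"] \<open>s > 0\<close> by simp
qed

lemma lambda_max_eq_1_iff:
  assumes "n > 0"
  shows "lambda_max (B * D * B) = 1 \<longleftrightarrow> eigenvalue (B * D * B) 1"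
proof -
  define R where "R = {r. eigenvalue (B * D * B) (complex_of_real r)}"
  have A: "B * D * B \<in> carrier_mat n n" using B D by simp
  \<comment> \<open>Since all eigenvalues are real, \<open>R\<close> inherits finiteness and
    nonemptiness from the complex spectrum, so \<open>Max R\<close> is a genuine maximum.\<close>
  have spec: "spectrum (B * D * B) = complex_of_real ` R"
    by (auto simp: spectrum_def R_def elim: eigenvalue_three_mat)
  then have fin: "finite R"
    using card_finite_spectrum(1)[OF A] by (simp add: finite_image_iff inj_on_def)
  have ne: "R \<noteq> {}" using spectrum_non_empty[OF A assms] spec by simp
  have le: "r \<le> 1" if "r \<in> R" for r
    using that by (auto simp: R_def elim: eigenvalue_three_mat)
  have "Max R = 1 \<longleftrightarrow> 1 \<in> R"
    using fin ne le by (auto simp: Max_eq_iff)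
  then show ?thesis by (simp add: lambda_max_def R_def)
qed

text \<open>A normalized common fixed vector attains the upper bound 1. Conversely, if there is
  none, the invertibility of \<open>1 - B * D * B\<close> bounds \<open>f\<close> on the unit sphere
  by a constant below 1, so attainment of the supremum need not be shown first.\<close>

lemma spectral_norm_mult_projectors_eq_1_iff:
  assumes "n > 0"
  shows "spectral_norm (D * B) = 1
    \<longleftrightarrow> (\<exists>x \<in> carrier_vec n. x \<noteq> 0\<^sub>v n \<and> perfectly_localized D B x)"
proof -
  define V where "V = {v :: complex Matrix.vec. v \<in> carrier_vec n \<and> l2_norm v = 1}"
  define f where "f v = l2_norm (D *\<^sub>v (B *\<^sub>v v))" for v
  have norm_eq: "spectral_norm (D * B) = (SUP v \<in> V. f v)"
    unfolding spectral_norm_def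
  proof (rule SUP_cong)
    show "{v \<in> carrier_vec (dim_col (D * B)). l2_norm v = 1} = V"
      using B by (auto simp: V_def)
  next
    fix v assume "v \<in> V"
    then show "l2_norm ((D * B) *\<^sub>v v) = f v"
      using assoc_mult_mat_vec[OF D B] by (simp add: V_def f_def)
  qed
  have f_le: "f v \<le> 1" if "v \<in> V" for v
    using that l2_norm_mult_projectors_le[of v] by (simp add: V_def f_def)
  have normalize: "(1 / complex_of_real (l2_norm x)) \<cdot>\<^sub>v x \<in> V"
    if "x \<in> carrier_vec n" "x \<noteq> 0\<^sub>v n" for x
    using that l2_norm_eq_0_iff[OF that(1)] l2_norm_nonneg[of x]
    by (simp add: V_def l2_norm_smult norm_divide)
  \<comment> \<open>The basis vector with index 0 exists because \<open>n > 0\<close>. A supremum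
    over an empty set of reals would be unspecified.\<close>
  have ne: "V \<noteq> {}"
    using normalize[of "unit_vec n 0"] assms by (auto simp: unit_vec_carrier)
  show ?thesis
  proof
    assume "\<exists>x \<in> carrier_vec n. x \<noteq> 0\<^sub>v n \<and> perfectly_localized D B x"
    then obtain x where x: "x \<in> carrier_vec n" "x \<noteq> 0\<^sub>v n" "D *\<^sub>v x = x" "B *\<^sub>v x = x"
      by (auto simp: perfectly_localized_def)
    let ?y = "(1 / complex_of_real (l2_norm x)) \<cdot>\<^sub>v x"
    have y: "?y \<in> V" using normalize x by simp
    have "D *\<^sub>v (B *\<^sub>v ?y) = ?y"
      using x by (simp add: mult_mat_vec[OF B] mult_mat_vec[OF D])
    then have "f ?y = 1" using y by (simp add: f_def V_def)
    moreover have "bdd_above (f ` V)" using f_le by (intro bdd_aboveI2)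
    ultimately have "1 \<le> (SUP v \<in> V. f v)" using cSUP_upper[OF y] by metis
    moreover have "(SUP v \<in> V. f v) \<le> 1" using ne f_le by (intro cSUP_least)
    ultimately show "spectral_norm (D * B) = 1" by (simp add: norm_eq)
  next
    assume one: "spectral_norm (D * B) = 1"
    show "\<exists>x \<in> carrier_vec n. x \<noteq> 0\<^sub>v n \<and> perfectly_localized D B x"
    proof (rule ccontr)
      assume "\<not> ?thesis"
      then have "\<not> eigenvalue (B * D * B) 1"
        using ex_perfectly_localized_iff_eigenvalue by simp
      moreover have A: "B * D * B \<in> carrier_mat n n" using B D by simp
      ultimately obtain K where
        K: "\<And>v. v \<in> carrier_vec n \<Longrightarrow> l2_norm v \<le> K * l2_norm (v - (B * D * B) *\<^sub>v v)"
        using l2_norm_le_diff_of_not_eigenvalue by blast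
      \<comment> \<open>With \<open>w = B D B v\<close>, the squared norm of \<open>v - w\<close> is
        \<open>1 - 2 f^2 + |w|^2\<close>, and \<open>|w|\<close> is at most \<open>f v\<close>; the
        inverse bound \<open>K\<close> then applies to \<open>v - w\<close>.\<close>
      have gap: "1 \<le> K\<^sup>2 * (1 - (f v)\<^sup>2)" if "v \<in> V" for v
      proof -
        have v: "v \<in> carrier_vec n" and nv: "l2_norm v = 1" using that by (auto simp: V_def)
        define w where "w = (B * D * B) *\<^sub>v v"
        have w: "w \<in> carrier_vec n" using A v by (simp add: w_def)
        have wv: "scalar_prod w (conjugate v) = complex_of_real ((f v)\<^sup>2)"
          unfolding w_def f_def by (rule scalar_prod_three_mat[OF v])
        \<comment> \<open>The two mixed inner products are conjugate to each other, and the first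
          one is real.\<close>
        have "scalar_prod v (conjugate w) = conjugate (scalar_prod w (conjugate v))"
          using conjugate_conjugate_sprod[OF v w] conjugate_vec_sprod_comm[OF w v] by simp
        then have vw: "scalar_prod v (conjugate w) = complex_of_real ((f v)\<^sup>2)"
          by (simp add: wv)
        have conj_diff: "conjugate (v - w) = conjugate v - conjugate w"
          using v w by (intro eq_vecI) auto
        have "complex_of_real ((l2_norm (v - w))\<^sup>2) = complex_of_real
            ((l2_norm v)\<^sup>2 - 2 * (f v)\<^sup>2 + (l2_norm w)\<^sup>2)"
          using v w wv vw
          by (simp add: l2_norm_square conj_diff minus_scalar_prod_distrib
              scalar_prod_minus_distrib carrier_vec_conjugate del: of_real_power)
        then have diff: "(l2_norm (v - w))\<^sup>2 = 1 - 2 * (f v)\<^sup>2 + (l2_norm w)\<^sup>2"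
          using nv by (simp only: of_real_eq_iff) simp
        have "l2_norm w \<le> f v"
          unfolding w_def f_def mult_three_mat_vec[OF v]
          using orthogonal_projector_contraction[OF projB B, of "D *\<^sub>v (B *\<^sub>v v)"] B D v
          by simp
        then have "(l2_norm w)\<^sup>2 \<le> (f v)\<^sup>2" by (simp add: power_mono l2_norm_nonneg)
        then have le: "(l2_norm (v - w))\<^sup>2 \<le> 1 - (f v)\<^sup>2" using diff by simp
        have "1 \<le> K * l2_norm (v - w)" using K[OF v] nv by (simp add: w_def)
        then have "1 \<le> (K * l2_norm (v - w))\<^sup>2" by (simp add: one_le_power)
        also have "\<dots> \<le> K\<^sup>2 * (1 - (f v)\<^sup>2)"
          unfolding power_mult_distrib using le by (intro mult_left_mono) auto
        finally show ?thesis .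
      qed
      obtain v0 where "v0 \<in> V" using ne by auto
      \<comment> \<open>For \<open>K = 0\<close> the gap inequality would read 1 \<le> 0.\<close>
      have K0: "K\<^sup>2 > 0"
        using gap[OF \<open>v0 \<in> V\<close>] by (cases "K = 0") auto
      have "f v \<le> sqrt (1 - 1 / K\<^sup>2)" if "v \<in> V" for v
      proof (rule real_le_rsqrt)
        show "(f v)\<^sup>2 \<le> 1 - 1 / K\<^sup>2" using gap[OF that] K0 by (simp add: field_simps)
      qed
      then have "(SUP v \<in> V. f v) \<le> sqrt (1 - 1 / K\<^sup>2)" using ne by (intro cSUP_least)
      also have "\<dots> < 1" using K0 by simp
      finally show False using one norm_eq by simp
    qed
  qed
qed

end

subsection \<open>Kronecker products\<close>

text \<open>Division with remainder by \<open>b\<close> is a bijection from the flat index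
  \<open>k\<close> to the pair \<open>(i, j)\<close>, with inverse \<open>i * b + j\<close>. It
  turns the inner sum of a product of Kronecker products into a double sum.\<close>

lemma sum_lessThan_mult_div_mod:
  fixes f :: "nat \<Rightarrow> nat \<Rightarrow> 'a :: comm_monoid_add"
  shows "(\<Sum>k<a * b. f (k div b) (k mod b)) = (\<Sum>i<a. \<Sum>j<b. f i j)"
proof -
  have lt: "i * b + j < a * b" if "i < a" "j < b" for i j
  proof -
    have "i * b + j < Suc i * b" using that by simp
    also have "\<dots> \<le> a * b" using that by (intro mult_right_mono) auto
    finally show ?thesis .
  qed
  have "(\<Sum>k<a * b. f (k div b) (k mod b)) = (\<Sum>(i, j) \<in> {..<a} \<times> {..<b}. f i j)"
  proof (rule sum.reindex_bij_witness[where j = "\<lambda>k. (k div b, k mod b)" and i = "\<lambda>(i, j). i * b + j"])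
    fix k assume "k \<in> {..<a * b}"
    then have "k < a * b" "b > 0" by (auto intro: Nat.gr0I)
    then show "(k div b, k mod b) \<in> {..<a} \<times> {..<b}"
      by (simp add: less_mult_imp_div_less)
  qed (auto intro: lt)
  then show ?thesis by (simp add: sum.cartesian_product)
qed

lemma kron_dim [simp]:
  "dim_row (kron A B) = dim_row A * dim_row B" "dim_col (kron A B) = dim_col A * dim_col B"
  by (simp_all add: kron_def)

lemma kron_carrier:
  assumes "A \<in> carrier_mat m n" "B \<in> carrier_mat p q"
  shows "kron A B \<in> carrier_mat (m * p) (n * q)"
  using assms by (intro carrier_matI) auto

lemma kron_index:
  assumes "i < dim_row A * dim_row B" "j < dim_col A * dim_col B"
  shows "kron A B $$ (i, j)
    = A $$ (i div dim_row B, j div dim_col B) * B $$ (i mod dim_row B, j mod dim_col B)"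
  using assms by (simp add: kron_def)

lemma div_mod_bounds:
  fixes i a b :: nat
  assumes "i < a * b"
  shows "i div b < a" "i mod b < b"
  using assms by (simp_all add: less_mult_imp_div_less, cases "b = 0") simp_all

text \<open>The mixed-product rule: once the summation index is split into quotient and remainder,
  the double sum factors into an entry of \<open>A * C\<close> times an entry of
  \<open>B * D\<close>.\<close>

lemma kron_mult:
  assumes "dim_col A = dim_row C" "dim_col B = dim_row D"
  shows "kron A B * kron C D = kron (A * C) (B * D)"
proof (rule eq_matI)
  fix i j assume ij: "i < dim_row (kron (A * C) (B * D))" "j < dim_col (kron (A * C) (B * D))"
  then have i: "i < dim_row A * dim_row B" and j: "j < dim_col C * dim_col D" by simp_all
  note b = div_mod_bounds[OF i] div_mod_bounds[OF j]
  let ?g = "\<lambda>k l. A $$ (i div dim_row B, k) * B $$ (i mod dim_row B, l)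
    * (C $$ (k, j div dim_col D) * D $$ (l, j mod dim_col D))"
  have "(kron A B * kron C D) $$ (i, j)
      = (\<Sum>k<dim_row C * dim_row D. kron A B $$ (i, k) * kron C D $$ (k, j))"
    using i j assms by (simp add: scalar_prod_def atLeast0LessThan)
  also have "\<dots> = (\<Sum>k<dim_row C * dim_row D. ?g (k div dim_row D) (k mod dim_row D))"
    using i j assms by (intro sum.cong) (simp_all add: kron_index)
  also have "\<dots> = (\<Sum>k<dim_row C. \<Sum>l<dim_row D. ?g k l)"
    by (rule sum_lessThan_mult_div_mod)
  also have "\<dots> = (\<Sum>k<dim_row C. A $$ (i div dim_row B, k) * C $$ (k, j div dim_col D))
      * (\<Sum>l<dim_row D. B $$ (i mod dim_row B, l) * D $$ (l, j mod dim_col D))"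
    by (simp add: sum_product mult_ac)
  also have "\<dots> = kron (A * C) (B * D) $$ (i, j)"
    using i j assms b by (simp add: kron_index scalar_prod_def atLeast0LessThan)
  finally show "(kron A B * kron C D) $$ (i, j) = kron (A * C) (B * D) $$ (i, j)" .
qed simp_all

lemma mat_adjoint_kron: "mat_adjoint (kron A B) = kron (mat_adjoint A) (mat_adjoint B)"
proof (rule eq_matI)
  fix i j
  assume "i < dim_row (kron (mat_adjoint A) (mat_adjoint B))"
    "j < dim_col (kron (mat_adjoint A) (mat_adjoint B))"
  then have i: "i < dim_col A * dim_col B" and j: "j < dim_row A * dim_row B" by simp_all
  show "mat_adjoint (kron A B) $$ (i, j) = kron (mat_adjoint A) (mat_adjoint B) $$ (i, j)"
    using i j div_mod_bounds[OF i] div_mod_bounds[OF j] by (simp add: kron_index)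
qed simp_all

text \<open>Adjoint and product both act factor by factor on \<open>kron\<close>, so
  self-adjointness and idempotency carry over.\<close>

lemma orthogonal_projector_kron:
  assumes "orthogonal_projector A" "orthogonal_projector B"
  shows "orthogonal_projector (kron A B)"
  using assms by (simp add: orthogonal_projector_def mat_adjoint_kron kron_mult)

section \<open>Sizes of the operators, and the joint theorem\<close>

lemma indicator_diag_carrier: "indicator_diag n A \<in> carrier_mat n n"
  by (simp add: indicator_diag_def)

lemma time_band_op_carrier: "time_band_op T u \<alpha> F \<in> carrier_mat T T"
  unfolding time_band_op_def dfrft_mat_def by (auto intro: carrier_matI)

lemma graph_band_op_carrier:
  assumes "S \<in> carrier_mat N N" "gft_decomposition S \<Delta> U Ui \<Lambda> Q Qi"
  shows "graph_band_op N \<Lambda> Q Qi \<beta> F \<in> carrier_mat N N"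
proof -
  have "Ui \<in> carrier_mat N N"
    using assms by (auto simp: gft_decomposition_def similar_mat_wit_def Let_def)
  then have "Q \<in> carrier_mat N N" "Qi \<in> carrier_mat N N"
    using assms(2) by (auto simp: gft_decomposition_def similar_mat_wit_def Let_def)
  then show ?thesis
    unfolding graph_band_op_def gfrft_mat_def by auto
qed

text \<open>The eigenvalue condition does not mention \<open>x\<close>, so the equivalence is given
  in two readings: existence of a nonzero localized vector, and, for a given nonzero
  \<open>x\<close>, the condition together with \<open>x\<close> being an eigenvector for 1. The
  zero vector is excluded because it is always localized.\<close>

theorem theorem1:
  fixes N T :: nat and E :: "(nat \<times> nat) set"
    and S \<Delta> U Ui \<Lambda> Q Qi :: "complex mat"
    and u :: "nat \<Rightarrow> real Matrix.vec"
    and \<alpha> \<beta> :: real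
    and S\<^sub>G S\<^sub>T F\<^sub>G F\<^sub>T :: "nat set"
  defines "D\<^sub>G \<equiv> indicator_diag N S\<^sub>G"
    and "D\<^sub>T \<equiv> indicator_diag T S\<^sub>T"
    and "B\<^sub>G \<equiv> graph_band_op N \<Lambda> Q Qi \<beta> F\<^sub>G"
    and "B\<^sub>T \<equiv> time_band_op T u \<alpha> F\<^sub>T"
  defines "D\<^sub>J \<equiv> kron D\<^sub>T D\<^sub>G"
    and "B\<^sub>J \<equiv> kron B\<^sub>T B\<^sub>G"
  assumes "N > 0" and "T > 0"
    and "graph_shift_operator N E S"
    and "gft_decomposition S \<Delta> U Ui \<Lambda> Q Qi"
    and "discrete_hermite_gaussian T u"
    and "S\<^sub>G \<subseteq> {..<N}" and "S\<^sub>T \<subseteq> {..<T}" and "F\<^sub>G \<subseteq> {..<N}" and "F\<^sub>T \<subseteq> {..<T}"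
    and "orthogonal_projector D\<^sub>G" and "orthogonal_projector D\<^sub>T"
    and "orthogonal_projector B\<^sub>G" and "orthogonal_projector B\<^sub>T"
  shows "((\<exists>x \<in> carrier_vec (N * T). x \<noteq> 0\<^sub>v (N * T) \<and> perfectly_localized D\<^sub>J B\<^sub>J x)
            \<longleftrightarrow> lambda_max (B\<^sub>J * D\<^sub>J * B\<^sub>J) = 1)
       \<and> (\<forall>x \<in> carrier_vec (N * T). x \<noteq> 0\<^sub>v (N * T) \<longrightarrow>
            (perfectly_localized D\<^sub>J B\<^sub>J x
             \<longleftrightarrow> lambda_max (B\<^sub>J * D\<^sub>J * B\<^sub>J) = 1 \<and> eigenvector (B\<^sub>J * D\<^sub>J * B\<^sub>J) x 1))
       \<and> (lambda_max (B\<^sub>J * D\<^sub>J * B\<^sub>J) = 1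
            \<longleftrightarrow> spectral_norm (B\<^sub>J * D\<^sub>J) = 1 \<and> spectral_norm (D\<^sub>J * B\<^sub>J) = 1)"
proof -
  have projD: "orthogonal_projector D\<^sub>J" and projB: "orthogonal_projector B\<^sub>J"
    unfolding D\<^sub>J_def B\<^sub>J_def
    by (intro orthogonal_projector_kron \<open>orthogonal_projector D\<^sub>T\<close> \<open>orthogonal_projector D\<^sub>G\<close>
        \<open>orthogonal_projector B\<^sub>T\<close> \<open>orthogonal_projector B\<^sub>G\<close>)+
  have S: "S \<in> carrier_mat N N" using \<open>graph_shift_operator N E S\<close> by (simp add: graph_shift_operator_def)
  have "D\<^sub>G \<in> carrier_mat N N" "D\<^sub>T \<in> carrier_mat T T"
    unfolding D\<^sub>G_def D\<^sub>T_def by (rule indicator_diag_carrier)+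
  then have D: "D\<^sub>J \<in> carrier_mat (N * T) (N * T)"
    unfolding D\<^sub>J_def mult.commute[of N T] by (intro kron_carrier)
  have "B\<^sub>G \<in> carrier_mat N N" "B\<^sub>T \<in> carrier_mat T T"
    unfolding B\<^sub>G_def B\<^sub>T_def
    by (rule graph_band_op_carrier[OF S \<open>gft_decomposition S \<Delta> U Ui \<Lambda> Q Qi\<close>])
      (rule time_band_op_carrier)
  then have B: "B\<^sub>J \<in> carrier_mat (N * T) (N * T)"
    unfolding B\<^sub>J_def mult.commute[of N T] by (intro kron_carrier)
  have n: "N * T > 0" using \<open>N > 0\<close> \<open>T > 0\<close> by simp
  note DB = projD D projB B
  have lmax: "lambda_max (B\<^sub>J * D\<^sub>J * B\<^sub>J) = 1 \<longleftrightarrow> eigenvalue (B\<^sub>J * D\<^sub>J * B\<^sub>J) 1"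
    by (rule lambda_max_eq_1_iff[OF DB n])
  have ex: "(\<exists>x \<in> carrier_vec (N * T). x \<noteq> 0\<^sub>v (N * T) \<and> perfectly_localized D\<^sub>J B\<^sub>J x)
      \<longleftrightarrow> lambda_max (B\<^sub>J * D\<^sub>J * B\<^sub>J) = 1"
    unfolding lmax by (rule ex_perfectly_localized_iff_eigenvalue[OF DB])
  \<comment> \<open>Localization is symmetric in the two projectors, so exchanging their roles gives
    the norm of \<open>B\<^sub>J * D\<^sub>J\<close> without passing to adjoints.\<close>
  have swap: "perfectly_localized B\<^sub>J D\<^sub>J x \<longleftrightarrow> perfectly_localized D\<^sub>J B\<^sub>J x" for x
    by (auto simp: perfectly_localized_def)
  have norms: "spectral_norm (D\<^sub>J * B\<^sub>J) = 1 \<longleftrightarrow> lambda_max (B\<^sub>J * D\<^sub>J * B\<^sub>J) = 1"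
    "spectral_norm (B\<^sub>J * D\<^sub>J) = 1 \<longleftrightarrow> lambda_max (B\<^sub>J * D\<^sub>J * B\<^sub>J) = 1"
    using spectral_norm_mult_projectors_eq_1_iff[OF DB n]
      spectral_norm_mult_projectors_eq_1_iff[OF projB B projD D n]
    unfolding swap ex by simp_all
  have vec: "perfectly_localized D\<^sub>J B\<^sub>J x
      \<longleftrightarrow> lambda_max (B\<^sub>J * D\<^sub>J * B\<^sub>J) = 1 \<and> eigenvector (B\<^sub>J * D\<^sub>J * B\<^sub>J) x 1"
    if "x \<in> carrier_vec (N * T)" "x \<noteq> 0\<^sub>v (N * T)" for x
    using perfectly_localized_iff_eigenvector[OF DB that] lmax by (auto simp: eigenvalue_def)
  show ?thesis using ex vec norms by blast
qed

end
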